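(* Let $d\ge 1$. Then $$\mathfrak{S}_{2d}^*=\{\mathbf{z}\in\mathbb{R}^{\pi(2d)}:\ \mathbf{M}_{2d}\text{ is positive semidefinite}\},$$ where $\mathbf{M}_{2d}=\mathbf{M}_{2d}(\mathbf{z})$ is the symmetric matrix whose rows and columns are indexed by the pairs $(\alpha,\lambda)$ with $\alpha\in\mathbb{N}^d$, $\lambda$ a (possibly empty) partition of size at most $d$, and $|\alpha|+|\lambda|=d$, and whose $((\alpha,\lambda),(\alpha',\lambda'))$ entry is $z_{(\alpha+\alpha')\lambda\lambda'}$. Here $(\alpha+\alpha')\lambda\lambda'$ denotes the partition of $2d$ whose parts are precisely the nonzero coordinates of $\alpha+\alpha'$ together with the parts of $\lambda$ and of $\lambda'$ (with multiplicity).
   Context: $\mathbb{N}=\{0,1,2,\dots\}$; $|\alpha|$ is the sum of the entries of $\alpha$ and $|\lambda|$ the sum of the parts of $\lambda$. $\pi(k)$ is the number of partitions of $k$; coordinates of $\mathbb{R}^{\pi(2d)}$ are indexed by partitions of $2d$. For $n,r\ge 1$ let $p_r^{(n)}=\frac{1}{n}(x_1^r+\dots+x_n^r)$ and, for a partition $\lambda$, $p_\lambda^{(n)}=\prod_{i}p_{\lambda_i}^{(n)}$. $\mathfrak{S}_{2d}$ is the set of $c\in\mathbb{R}^{\pi(2d)}$ such that $\sum_{\lambda\vdash 2d}c_\lambda p_\lambda^{(n)}$ is a sum of squares of real polynomials for every $n\ge 2d$. (It is known that $\mathfrak{S}_{2d}$ is also the closure of $\bigcup_{n\ge 2d}\{c:\sum_{\lambda\vdash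 2d} c_\lambda m_\lambda^{(n)}\text{ is a sum of squares}\}$, where $m_\lambda^{(n)}$ is the arithmetic mean of all monomials obtained by permuting the variables $x_1,\dots,x_n$ in $x_1^{\lambda_1}x_2^{\lambda_2}\cdots$.) The dual cone is $\mathfrak{S}_{2d}^*=\{\mathbf{z}\in\mathbb{R}^{\pi(2d)}:\sum_{\lambda}z_\lambda c_\lambda\ge 0\ \text{for all } c\in\mathfrak{S}_{2d}\}$. *)

theory Defs
  imports Complex_Main "HOL-Library.Poly_Mapping" "HOL-Library.Multiset" "HOL-Library.FuncSet"
begin

text \<open>
  A monomial is a finitely supported exponent vector, a polynomial a finitely supported
  family of coefficients on monomials; \<^typ>\<open>(nat \<Rightarrow>\<^sub>0 nat) \<Rightarrow>\<^sub>0 real\<close> carries the convolution product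
  and so is the polynomial ring in countably many variables. The variables
  \<open>x\<^sub>1, ..., x\<^sub>n\<close> are numbered from \<open>0\<close> to \<open>n - 1\<close>.
\<close>

type_synonym rpoly = "(nat \<Rightarrow>\<^sub>0 nat) \<Rightarrow>\<^sub>0 real"

definition const_poly :: "real \<Rightarrow> rpoly" where
  "const_poly a = Poly_Mapping.single 0 a"

definition var_poly :: "nat \<Rightarrow> rpoly" where
  "var_poly i = Poly_Mapping.single (Poly_Mapping.single i 1) 1"

definition polys_in :: "nat \<Rightarrow> rpoly set" where
  "polys_in n = {q. \<forall>m \<in> Poly_Mapping.keys q. Poly_Mapping.keys m \<subseteq> {..<n}}"

definition sum_of_squares :: "nat \<Rightarrow> rpoly \<Rightarrow> bool" where
  "sum_of_squares n f \<longleftrightarrow>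
     (\<exists>(k::nat) q. (\<forall>j<k. q j \<in> polys_in n) \<and> f = (\<Sum>j<k. (q j)^2))"

definition partitions_of :: "nat \<Rightarrow> nat multiset set" where
  "partitions_of k = {\<mu>. 0 \<notin># \<mu> \<and> sum_mset \<mu> = k}"

lemma finite_partitions_of: "finite (partitions_of k)"
proof (rule finite_subset)
  show "partitions_of k \<subseteq> mset ` {xs. set xs \<subseteq> {..k} \<and> length xs \<le> k}"
  proof
    fix \<mu> assume "\<mu> \<in> partitions_of k"
    then have z: "0 \<notin># \<mu>" and s: "sum_mset \<mu> = k"
      by (auto simp: partitions_of_def)
    obtain xs where xs: "mset xs = \<mu>"
      using ex_mset by blast
    have sl: "sum_list xs = k"
      using s sum_mset_sum_list[of xs] unfolding xs by simp
    have n0: "0 \<notin> set xs"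
      using z unfolding xs[symmetric] by simp
    have "length ys \<le> sum_list ys" if "0 \<notin> set ys" for ys :: "nat list"
      using that by (induction ys) auto
    from this[OF n0] have "length xs \<le> k"
      unfolding sl .
    moreover have "set xs \<subseteq> {..k}"
      using member_le_sum_list[of _ xs] unfolding sl by blast
    ultimately show "\<mu> \<in> mset ` {xs. set xs \<subseteq> {..k} \<and> length xs \<le> k}"
      using xs by blast
  qed
  show "finite (mset ` {xs. set xs \<subseteq> {..k} \<and> length xs \<le> k})"
    by (intro finite_imageI finite_lists_length_le) simp
qed

definition power_mean :: "nat \<Rightarrow> nat \<Rightarrow> rpoly" where
  "power_mean n r = const_poly (1 / real n) * (\<Sum>i<n. var_poly i ^ r)"

definition power_mean_partition :: "nat \<Rightarrow> nat multiset \<Rightarrow> rpoly" where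
  "power_mean_partition n \<mu> = (\<Prod>r\<in>#\<mu>. power_mean n r)"

text \<open>
  For a finite index set \<open>I\<close>, the space of real vectors indexed by \<open>I\<close> is
  \<open>I \<rightarrow>\<^sub>E UNIV\<close>: vectors are functions fixed to be \<open>undefined\<close> off \<open>I\<close>,
  so that two of them are equal iff all their coordinates are.
\<close>

definition sos_cone :: "nat \<Rightarrow> (nat multiset \<Rightarrow> real) set" where
  "sos_cone d = {c \<in> partitions_of (2 * d) \<rightarrow>\<^sub>E UNIV.
     \<forall>n \<ge> 2 * d. sum_of_squares n
       (\<Sum>\<mu>\<in>partitions_of (2 * d). const_poly (c \<mu>) * power_mean_partition n \<mu>)}"

definition dual_cone :: "'i set \<Rightarrow> ('i \<Rightarrow> real) set \<Rightarrow> ('i \<Rightarrow> real) set" where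
  "dual_cone I K = {z \<in> I \<rightarrow>\<^sub>E UNIV. \<forall>c\<in>K. 0 \<le> (\<Sum>i\<in>I. z i * c i)}"

definition positive_semidefinite :: "'i set \<Rightarrow> ('i \<Rightarrow> 'i \<Rightarrow> real) \<Rightarrow> bool" where
  "positive_semidefinite I A \<longleftrightarrow>
     (\<forall>i\<in>I. \<forall>j\<in>I. A i j = A j i) \<and>
     (\<forall>v. 0 \<le> (\<Sum>i\<in>I. \<Sum>j\<in>I. v i * A i j * v j))"

definition matrix_index :: "nat \<Rightarrow> ((nat \<Rightarrow> nat) \<times> nat multiset) set" where
  "matrix_index d = {(\<alpha>, \<mu>). \<alpha> \<in> {..<d} \<rightarrow>\<^sub>E UNIV \<and>
     (\<exists>k\<le>d. \<mu> \<in> partitions_of k \<and> (\<Sum>i<d. \<alpha> i) + k = d)}"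

lemma finite_matrix_index: "finite (matrix_index d)"
proof (rule finite_subset)
  show "matrix_index d \<subseteq> ({..<d} \<rightarrow>\<^sub>E {..d}) \<times> (\<Union>k\<le>d. partitions_of k)"
  proof
    fix p assume "p \<in> matrix_index d"
    then obtain \<alpha> \<mu> k where p: "p = (\<alpha>, \<mu>)" and a: "\<alpha> \<in> {..<d} \<rightarrow>\<^sub>E UNIV"
      "(\<Sum>i<d. \<alpha> i) + k = d" "k \<le> d" "\<mu> \<in> partitions_of k"
      unfolding matrix_index_def by blast
    have "\<alpha> i \<le> d" if "i < d" for i
      using member_le_sum[of i "{..<d}" \<alpha>] that a(2) by simp
    then have "\<alpha> \<in> {..<d} \<rightarrow>\<^sub>E {..d}"
      using a(1) by (simp add: PiE_iff)
    then show "p \<in> ({..<d} \<rightarrow>\<^sub>E {..d}) \<times> (\<Union>k\<le>d. partitions_of k)"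
      using a(3,4) p by blast
  qed
  show "finite (({..<d} \<rightarrow>\<^sub>E {..d}) \<times> (\<Union>k\<le>d. partitions_of k))"
    by (auto intro!: finite_PiE finite_partitions_of)
qed

definition exponent_partition :: "nat \<Rightarrow> (nat \<Rightarrow> nat) \<Rightarrow> nat multiset" where
  "exponent_partition d \<beta> = filter_mset (\<lambda>k. k \<noteq> 0) (image_mset \<beta> (mset_set {..<d}))"

definition moment_matrix ::
  "nat \<Rightarrow> (nat multiset \<Rightarrow> real) \<Rightarrow>
   (nat \<Rightarrow> nat) \<times> nat multiset \<Rightarrow> (nat \<Rightarrow> nat) \<times> nat multiset \<Rightarrow> real" where
  "moment_matrix d z = (\<lambda>(\<alpha>, \<mu>) (\<alpha>', \<mu>').
     z (exponent_partition d (\<lambda>i. \<alpha> i + \<alpha>' i) + \<mu> + \<mu>'))"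

end

theory Submission
  imports Defs
begin

text \<open>
  A vector \<open>z\<close> defines a functional \<open>E\<close> on polynomials in variables \<open>x\<^sub>i\<close> and formal power means
  \<open>p\<^sub>r\<close> by \<open>E (x\<^sup>\<alpha> p\<^sub>\<mu>) = z\<^bsub>\<alpha>\<mu>\<^esub>\<close>, as if the \<open>x\<^sub>i\<close> were, given the \<open>p\<^sub>r\<close>, independent and
  identically distributed with moments \<open>p\<^sub>r\<close>. Positive semidefiniteness of the moment matrix says that
  \<open>E (q\<^sup>2) \<ge> 0\<close> for \<open>q\<close> homogeneous of degree \<open>d\<close> in \<open>d\<close> of the variables.

  If \<open>z\<close> is in the dual cone, such a \<open>q\<^sup>2\<close> averaged over all substitutions of \<open>n\<close> variables for the
  \<open>x\<^sub>i\<close> is a sum of squares whose coefficients in the basis of power mean products do not depend on \<open>n\<close>.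

  Conversely, the Hoeffding decomposition of a form \<open>q\<close> of degree \<open>d\<close> in arbitrarily many variables
  is \<open>E\<close>-orthogonal and has only components in at most \<open>d\<close> variables, so \<open>E (q\<^sup>2) \<ge> 0\<close> for all of them.
  Hence \<open>E\<close> is nonnegative on \<open>\<Sum> c\<^sub>\<lambda> p\<^sub>\<lambda>\<close> in \<open>n\<close> variables when \<open>c\<close> is in the cone, and as
  \<open>n\<close> grows its value tends to \<open>\<Sum> c\<^sub>\<lambda> z\<^sub>\<lambda>\<close>.
\<close>

section \<open>Kernels on formal combinations and commuting self-adjoint idempotents\<close>

text \<open>A list of weighted basis elements stands for a formal linear combination. Repeated
  elements are allowed, so addition is concatenation, and a map that merges basis elements acts
  entrywise without collecting coefficients.\<close>

definition kernel_form :: "('m \<Rightarrow> 'm \<Rightarrow> real) \<Rightarrow> (real \<times> 'm) list \<Rightarrow> (real \<times> 'm) list \<Rightarrow> real" where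
  "kernel_form K U V = (\<Sum>(c, s)\<leftarrow>U. \<Sum>(c', t)\<leftarrow>V. c * c' * K s t)"

lemma kernel_form_append:
  "kernel_form K (U @ U') V = kernel_form K U V + kernel_form K U' V"
  "kernel_form K U (V @ V') = kernel_form K U V + kernel_form K U V'"
  by (simp_all add: kernel_form_def case_prod_unfold sum_list_addf)

lemma kernel_form_uminus:
  "kernel_form K (map (\<lambda>(c, s). (- c, f s)) U) V = - kernel_form K (map (\<lambda>(c, s). (c, f s)) U) V"
  "kernel_form K U (map (\<lambda>(c, s). (- c, f s)) V) = - kernel_form K U (map (\<lambda>(c, s). (c, f s)) V)"
  by (simp_all add: kernel_form_def case_prod_unfold o_def uminus_sum_list_map)

lemma kernel_form_eq_0:
  assumes "\<And>c t. (c, t) \<in> set V \<Longrightarrow> kernel_form K U [(1, t)] = 0"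
  shows "kernel_form K U V = 0"
  using assms
proof (induction V)
  case Nil
  then show ?case by (simp add: kernel_form_def case_prod_unfold)
next
  case (Cons a V)
  obtain c t where a: "a = (c, t)" by force
  have "kernel_form K U [a] = c * kernel_form K U [(1, t)]"
    using sum_list_const_mult[of c "\<lambda>(c', s). c' * K s t" U]
    by (simp add: a kernel_form_def case_prod_unfold mult_ac)
  then have "kernel_form K U [a] = 0"
    using Cons.prems[of c t] by (simp add: a)
  then show ?case
    using kernel_form_append(2)[of K U "[a]" V] Cons by auto
qed

lemma kernel_form_map_adjoint:
  assumes "\<And>s t. K (f s) t = K s (f t)"
  shows "kernel_form K (map (\<lambda>(c, s). (c, f s)) U) V = kernel_form K U (map (\<lambda>(c, s). (c, f s)) V)"
  by (simp add: kernel_form_def case_prod_unfold o_def assms)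

text \<open>
  Each \<open>P i\<close> extends to a self-adjoint idempotent on formal combinations, so that
  \<open>u = P i u + (u - P i u)\<close> is an orthogonal splitting. After splitting along all \<open>i\<close>, a component
  on which more than \<open>d\<close> of the projections vanish is isotropic, because each of its basis
  elements is fixed by one of them.
\<close>

lemma kernel_form_nonneg:
  fixes K :: "'m \<Rightarrow> 'm \<Rightarrow> real" and P :: "'i \<Rightarrow> 'm \<Rightarrow> 'm"
  assumes fin: "finite I"
    and adj: "\<And>i s t. i \<in> I \<Longrightarrow> K (P i s) t = K s (P i t)"
    and idem: "\<And>i s. i \<in> I \<Longrightarrow> P i (P i s) = P i s"
    and comm: "\<And>i j s. i \<in> I \<Longrightarrow> j \<in> I \<Longrightarrow> P i (P j s) = P j (P i s)"
    and closed: "\<And>i s. i \<in> I \<Longrightarrow> s \<in> D \<Longrightarrow> P i s \<in> D"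
    and gap: "\<And>S s. S \<subseteq> I \<Longrightarrow> card S > d \<Longrightarrow> s \<in> D \<Longrightarrow> \<exists>i\<in>S. P i s = s"
    and base: "\<And>S U. S \<subseteq> I \<Longrightarrow> card S \<le> d \<Longrightarrow>
      snd ` set U \<subseteq> {s \<in> D. \<forall>i\<in>I - S. P i s = s} \<Longrightarrow> 0 \<le> kernel_form K U U"
    and U: "snd ` set U \<subseteq> D"
  shows "0 \<le> kernel_form K U U"
proof -
  \<comment> \<open>Invariant: \<open>R\<close> holds the indices still to be split along. The
    projections for \<open>S\<close> kill \<open>U\<close>, though only modulo the radical of
    \<open>K\<close>. Every remaining index fixes all basis elements of \<open>U\<close>.\<close>
  have main: "0 \<le> kernel_form K U U"
    if "finite R" "R \<subseteq> I" "S \<subseteq> I"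
      "snd ` set U \<subseteq> {s \<in> D. \<forall>i\<in>I - (S \<union> R). P i s = s}"
      "\<And>i t. i \<in> S \<Longrightarrow> kernel_form K (map (\<lambda>(c, s). (c, P i s)) U) [(1, t)] = 0" for R S U
    using that
  proof (induction R arbitrary: S U rule: finite_induct)
    case empty
    show ?case
    proof (cases "card S \<le> d")
      case True
      then show ?thesis using base[of S U] empty by auto
    next
      case False
      have "kernel_form K U [(1, t)] = 0" if "(c, t) \<in> set U" for c t
      proof -
        have "t \<in> D" using that empty.prems(3) by force
        then obtain i where i: "i \<in> S" "P i t = t"
          using gap[of S t] False empty.prems by auto
        then have "kernel_form K U [(1, t)] = kernel_form K U (map (\<lambda>(c, s). (c, P i s)) [(1, t)])"
          by simp
        also have "\<dots> = 0"
          using empty.prems(4)[OF i(1), of t] i empty.prems(2) adj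
          by (subst kernel_form_map_adjoint[symmetric]) auto
        finally show ?thesis .
      qed
      then show ?thesis using kernel_form_eq_0 by (metis order_refl)
    qed
  next
    case (insert i R)
    have i: "i \<in> I" using insert by auto
    \<comment> \<open>\<open>U1\<close> represents the image of \<open>U\<close> under the
      projection for \<open>i\<close>, and \<open>U2\<close> the complement. In the recursion
      \<open>i\<close> joins the fixing indices for \<open>U1\<close> and joins \<open>S\<close> for
      \<open>U2\<close>.\<close>
    let ?p = "\<lambda>j. map (\<lambda>(c, s). (c, P j s))"
    define U1 where "U1 = ?p i U"
    define U2 where "U2 = U @ map (\<lambda>(c, s). (- c, P i s)) U"
    note adj' = kernel_form_map_adjoint[of K, OF adj]
    have pp: "?p i (?p i V) = ?p i V" for V
      using idem[OF i] by auto
    have pc: "?p i (?p j V) = ?p j (?p i V)" if "j \<in> I" for j V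
      using comm[OF i that] by auto
    \<comment> \<open>With p the projection, self-adjointness and idempotence give K(pU, pU) = K(pU,
      U) = K(U, pU), so the cross terms cancel.\<close>
    have split: "kernel_form K U U = kernel_form K U1 U1 + kernel_form K U2 U2"
      using adj'[OF i, of U U] adj'[OF i, of "?p i U" U] adj'[OF i, of U "?p i U"]
      unfolding pp by (simp add: U1_def U2_def kernel_form_append kernel_form_uminus)
    have "snd ` set U1 \<subseteq> {s \<in> D. \<forall>j\<in>I - (S \<union> R). P j s = s}"
    proof -
      have "P i s \<in> D \<and> (\<forall>j\<in>I - (S \<union> R). P j (P i s) = P i s)" if "(c, s) \<in> set U" for c s
      proof -
        have s: "s \<in> D" "\<forall>j\<in>I - (S \<union> insert i R). P j s = s"
          using subsetD[OF insert.prems(3), of s] image_eqI[OF _ that, of s snd] by auto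
        have "P j (P i s) = P i s" if "j \<in> I - (S \<union> R)" for j
          using that s(2) idem[OF i] comm[of j i s] i by (cases "j = i") auto
        then show ?thesis using closed[OF i s(1)] by auto
      qed
      then show ?thesis unfolding U1_def by fastforce
    qed
    moreover have z1: "kernel_form K (?p j U1) [(1, t)] = 0" if "j \<in> S" for j t
    proof -
      have "kernel_form K (?p j U1) [(1, t)] = kernel_form K (?p j U) (?p i [(1, t)])"
      proof -
        have "j \<in> I" using that insert.prems(2) by blast
        show ?thesis unfolding U1_def pc[symmetric, OF \<open>j \<in> I\<close>] by (rule adj'[OF i])
      qed
      then show ?thesis using insert.prems(4)[OF that, of "P i t"] by simp
    qed
    ultimately have n1: "0 \<le> kernel_form K U1 U1"
      using insert by auto
    have "snd ` set U2 \<subseteq> {s \<in> D. \<forall>j\<in>I - (insert i S \<union> R). P j s = s}"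
    proof -
      have "P i s \<in> D \<and> (\<forall>j\<in>I - (insert i S \<union> R). P j (P i s) = P i s)" if "(c, s) \<in> set U" for c s
      proof -
        have s: "s \<in> D" "\<forall>j\<in>I - (S \<union> insert i R). P j s = s"
          using subsetD[OF insert.prems(3), of s] image_eqI[OF _ that, of s snd] by auto
        have "P j (P i s) = P i s" if "j \<in> I - (insert i S \<union> R)" for j
          using that s(2) comm[of j i s] i by auto
        then show ?thesis using closed[OF i s(1)] by auto
      qed
      then show ?thesis using insert.prems(3) unfolding U2_def by fastforce
    qed
    moreover have "kernel_form K (?p j U2) [(1, t)] = 0" if "j \<in> insert i S" for j t
    proof -
      have "?p j U2 = ?p j U @ map (\<lambda>(c, s). (- c, P j (P i s))) U"
        by (auto simp: U2_def)
      moreover have "map (\<lambda>(c, s). (c, P j (P i s))) U = ?p j U1"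
        by (auto simp: U1_def)
      ultimately have "kernel_form K (?p j U2) [(1, t)] =
          kernel_form K (?p j U) [(1, t)] - kernel_form K (?p j U1) [(1, t)]"
        using kernel_form_uminus(1)[of K "\<lambda>s. P j (P i s)" U "[(1, t)]"]
        by (simp add: kernel_form_append)
      also have "\<dots> = 0"
      proof (cases "j = i")
        case True
        then show ?thesis by (simp only: U1_def pp)
      next
        case False
        then show ?thesis using that z1[of j t] insert.prems(4)[of j t] by simp
      qed
      finally show ?thesis .
    qed
    ultimately have "0 \<le> kernel_form K U2 U2"
      using insert.IH[of "insert i S" U2] insert.prems(1,2) by blast
    then show ?case using n1 split by simp
  qed
  show ?thesis
    using main[of I "{}" U] fin U by auto
qed

section \<open>The moment kernel in arbitrarily many variables\<close>

text \<open>Only the multiset of nonzero exponents matters, so it can be read off along any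
  injection whose image covers the support. This serves both for relabelling variables and for
  monomials built from tuples of indices.\<close>

lemma exponent_partition_reindex:
  assumes "finite A" "inj_on k A" "k ` A \<subseteq> {..<n}"
    and "\<And>i. i \<in> A \<Longrightarrow> a (k i) = r i"
    and "\<And>j. j < n \<Longrightarrow> j \<notin> k ` A \<Longrightarrow> a j = 0"
  shows "exponent_partition n a = filter_mset (\<lambda>x. x \<noteq> 0) (image_mset r (mset_set A))"
proof -
  have "{..<n} = k ` A \<union> ({..<n} - k ` A)" using assms(3) by auto
  then have "mset_set {..<n} = mset_set (k ` A) + mset_set ({..<n} - k ` A)"
    using assms(1) mset_set_Union[of "k ` A" "{..<n} - k ` A"] by auto
  moreover have "filter_mset (\<lambda>x. x \<noteq> 0) (image_mset a (mset_set ({..<n} - k ` A))) = {#}"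
    using assms(5) by (auto simp: filter_mset_eq_conv)
  moreover have "image_mset a (mset_set (k ` A)) = image_mset r (mset_set A)"
    using assms(1,2,4)
    by (auto simp: image_mset_mset_set[symmetric] multiset.map_comp intro!: image_mset_cong)
  ultimately show ?thesis
    by (simp add: exponent_partition_def)
qed

lemma sum_exponent_partition: "sum_mset (exponent_partition n a) = (\<Sum>i<n. a i)"
proof -
  have "sum_mset (filter_mset (\<lambda>x. x \<noteq> 0) M) = sum_mset M" for M :: "nat multiset"
    by (induction M) auto
  then show ?thesis
    by (simp add: exponent_partition_def sum_unfold_sum_mset)
qed

lemma zero_notin_exponent_partition: "0 \<notin># exponent_partition n a"
  by (simp add: exponent_partition_def)

text \<open>Conditional expectation given the moments: \<open>x\<^sub>i ^ r\<close> is replaced by \<open>p\<^sub>r\<close>.\<close>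

definition integrate_out :: "nat \<Rightarrow> (nat \<Rightarrow> nat) \<times> nat multiset \<Rightarrow> (nat \<Rightarrow> nat) \<times> nat multiset" where
  "integrate_out i = (\<lambda>(a, \<mu>). (a(i := 0), filter_mset (\<lambda>x. x \<noteq> 0) {#a i#} + \<mu>))"

lemma exponent_partition_upd_0:
  assumes "i < n"
  shows "exponent_partition n a = exponent_partition n (a(i := 0)) + filter_mset (\<lambda>x. x \<noteq> 0) {#a i#}"
proof -
  have "{..<n} = insert i ({..<n} - {i})" using assms by auto
  then have "mset_set {..<n} = add_mset i (mset_set ({..<n} - {i}))"
    by (metis finite_Diff finite_lessThan insert_Diff_single insert_iff mset_set.insert_remove)
  then show ?thesis
    by (auto simp: exponent_partition_def intro!: arg_cong[of _ _ "filter_mset _"] image_mset_cong)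
qed

text \<open>On either side the exponents of the two factors at \<open>i\<close> no longer add up but
  enter as two separate parts, which is symmetric in \<open>s\<close> and \<open>t\<close>.\<close>

lemma integrate_out_adjoint:
  assumes "i < n"
  shows "moment_matrix n z (integrate_out i s) t = moment_matrix n z s (integrate_out i t)"
proof -
  obtain a \<mu> b \<nu> where st: "s = (a, \<mu>)" "t = (b, \<nu>)" by force
  let ?s = "\<lambda>x::nat. filter_mset (\<lambda>x. x \<noteq> 0) {#x#}"
  let ?c = "exponent_partition n ((\<lambda>j. a j + b j)(i := 0))"
  have "(\<lambda>j. (a(i := 0)) j + b j)(i := 0) = (\<lambda>j. a j + b j)(i := 0)"
    "(\<lambda>j. a j + (b(i := 0)) j)(i := 0) = (\<lambda>j. a j + b j)(i := 0)" by auto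
  then have "exponent_partition n (\<lambda>j. (a(i := 0)) j + b j) = ?c + ?s (b i)"
    "exponent_partition n (\<lambda>j. a j + (b(i := 0)) j) = ?c + ?s (a i)"
    using exponent_partition_upd_0[OF assms, of "\<lambda>j. (a(i := 0)) j + b j"]
      exponent_partition_upd_0[OF assms, of "\<lambda>j. a j + (b(i := 0)) j"] by simp_all
  then show ?thesis
    by (simp add: st integrate_out_def moment_matrix_def ac_simps)
qed

lemma integrate_out_idem: "integrate_out i (integrate_out i s) = integrate_out i s"
  by (auto simp: integrate_out_def split: prod.splits)

lemma integrate_out_commute: "integrate_out i (integrate_out j s) = integrate_out j (integrate_out i s)"
  by (cases "i = j") (auto simp: integrate_out_def fun_upd_twist split: prod.splits)

lemma integrate_out_fixed_iff: "integrate_out i (a, \<mu>) = (a, \<mu>) \<longleftrightarrow> a i = 0"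
  by (auto simp: integrate_out_def fun_upd_idem_iff)

text \<open>A formal power mean p_r has weight r. Values of \<open>a\<close> from \<open>n\<close>
  onwards are left free, since the kernel in \<open>n\<close> variables never reads them.\<close>

definition weighted_monomials :: "nat \<Rightarrow> nat \<Rightarrow> ((nat \<Rightarrow> nat) \<times> nat multiset) set" where
  "weighted_monomials n d = {(a, \<mu>). 0 \<notin># \<mu> \<and> (\<Sum>i<n. a i) + sum_mset \<mu> = d}"

lemma integrate_out_weighted:
  assumes "i < n" "s \<in> weighted_monomials n d"
  shows "integrate_out i s \<in> weighted_monomials n d"
proof -
  obtain a \<mu> where s: "s = (a, \<mu>)" by force
  have "(\<Sum>j<n. a j) = (\<Sum>j<n. (a(i := 0)) j) + a i"
    using arg_cong[OF exponent_partition_upd_0[OF assms(1), of a], of sum_mset]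
    unfolding sum_mset.union sum_exponent_partition by simp
  then show ?thesis using assms(2)
    by (auto simp: s integrate_out_def weighted_monomials_def)
qed

text \<open>Total degree d leaves room for at most d positive exponents. This is why components in
  more than d variables drop out.\<close>

lemma card_gap_weighted:
  assumes "S \<subseteq> {..<n}" "card S > d" "s \<in> weighted_monomials n d"
  shows "\<exists>i\<in>S. integrate_out i s = s"
proof (rule ccontr)
  assume neg: "\<not> ?thesis"
  obtain a \<mu> where s: "s = (a, \<mu>)" by force
  have "a i \<ge> 1" if "i \<in> S" for i
    using neg that by (auto simp: s integrate_out_fixed_iff Suc_le_eq)
  then have "card S \<le> sum a S" using sum_mono[of S "\<lambda>_. 1" a] by simp
  also have "\<dots> \<le> sum a {..<n}" using assms(1) by (intro sum_mono2) auto
  finally show False using assms(2,3) by (simp add: s weighted_monomials_def)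
qed

text \<open>Pushing the coefficients of \<open>U\<close> forward along \<open>g\<close> gives a
  vector on \<open>I\<close> with the same quadratic form. The map \<open>g\<close> may identify
  basis elements, whose coefficients then add up in \<open>v\<close>.\<close>

lemma kernel_form_nonneg_if_factors:
  assumes psd: "positive_semidefinite I A" and fin: "finite I"
    and I: "\<And>s. s \<in> snd ` set U \<Longrightarrow> g s \<in> I"
    and K: "\<And>s t. s \<in> snd ` set U \<Longrightarrow> t \<in> snd ` set U \<Longrightarrow> K s t = A (g s) (g t)"
  shows "0 \<le> kernel_form K U U"
proof -
  define v where "v i = (\<Sum>(c, s)\<leftarrow>U. if g s = i then c else 0)" for i
  have *: "(\<Sum>(c, s)\<leftarrow>V. c * h (g s)) = (\<Sum>i\<in>I. (\<Sum>(c, s)\<leftarrow>V. if g s = i then c else 0) * h i)"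
    if "snd ` set V \<subseteq> snd ` set U" for h :: "'a \<Rightarrow> real" and V
    using that
  proof (induction V)
    case Nil
    then show ?case by simp
  next
    case (Cons a V)
    obtain c s where a: "a = (c, s)" by force
    have "g s \<in> I" using I Cons.prems by (auto simp: a)
    then have "(\<Sum>i\<in>I. (if g s = i then c else 0) * h i) = c * h (g s)"
      using fin by (simp add: if_distrib[of "\<lambda>x. x * _"] cong: if_cong)
    then show ?case using Cons by (simp add: a distrib_right sum.distrib)
  qed
  have "kernel_form K U U = (\<Sum>(c, s)\<leftarrow>U. c * (\<Sum>(c', t)\<leftarrow>U. c' * A (g s) (g t)))"
  proof -
    have "(\<Sum>(c', t)\<leftarrow>U. c * c' * K s t) = c * (\<Sum>(c', t)\<leftarrow>U. c' * A (g s) (g t))"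
      if "(c, s) \<in> set U" for c s
    proof -
      have "K s t = A (g s) (g t)" if "(c', t) \<in> set U" for c' t
        using K[of s t] that \<open>(c, s) \<in> set U\<close> by force
      then have "(\<Sum>(c', t)\<leftarrow>U. c * c' * K s t) = (\<Sum>p\<leftarrow>U. c * (\<lambda>(c', t). c' * A (g s) (g t)) p)"
        by (auto intro!: arg_cong[of _ _ sum_list])
      then show ?thesis by (simp only: sum_list_const_mult)
    qed
    then show ?thesis
      unfolding kernel_form_def by (intro arg_cong[of _ _ sum_list]) auto
  qed
  also have "\<dots> = (\<Sum>(c, s)\<leftarrow>U. c * (\<Sum>j\<in>I. v j * A (g s) j))"
    by (subst *) (simp_all add: v_def)
  also have "\<dots> = (\<Sum>i\<in>I. v i * (\<Sum>j\<in>I. v j * A i j))"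
    by (subst *[where h = "\<lambda>i. \<Sum>j\<in>I. v j * A i j"]) (simp_all add: v_def)
  also have "\<dots> = (\<Sum>i\<in>I. \<Sum>j\<in>I. v i * A i j * v j)"
    by (simp add: sum_distrib_left mult_ac)
  finally show ?thesis
    using psd by (simp add: positive_semidefinite_def)
qed

lemma moment_kernel_nonneg:
  assumes psd: "positive_semidefinite (matrix_index d) (moment_matrix d z)"
    and U: "snd ` set U \<subseteq> weighted_monomials n d"
  shows "0 \<le> kernel_form (moment_matrix n z) U U"
proof (rule kernel_form_nonneg[where I = "{..<n}" and P = integrate_out
      and D = "weighted_monomials n d" and d = d])
  fix S and U :: "(real \<times> (nat \<Rightarrow> nat) \<times> nat multiset) list"
  assume S: "S \<subseteq> {..<n}" "card S \<le> d"
    and U: "snd ` set U \<subseteq> {s \<in> weighted_monomials n d. \<forall>i\<in>{..<n} - S. integrate_out i s = s}"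
  have finS: "finite S" using S finite_subset by blast
  then obtain f where f: "bij_betw f {..<card S} S"
    using ex_bij_betw_nat_finite[of S] by (auto simp: atLeast0LessThan)
  let ?A = "{..<card S}"
  \<comment> \<open>The at most d variables indexed by \<open>S\<close> are renamed to the first
    ones by \<open>f\<close>, and the exponents are padded with zeros up to d. Restriction to
    \<open>{..<d}\<close> makes the result extensional, as \<open>matrix_index\<close>
    demands.\<close>
  define g where "g = (\<lambda>(a, \<mu>::nat multiset). (\<lambda>j\<in>{..<d}. if j < card S then a (f j) else (0::nat), \<mu>))"
  \<comment> \<open>Both sides collect the nonzero exponents over \<open>S\<close>: the left through
    \<open>f\<close>, the right through the identity, which fits because
    \<open>card S \<le> d\<close>.\<close>
  have ep: "exponent_partition n c = exponent_partition d c'"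
    if "\<And>i. i < n \<Longrightarrow> i \<notin> S \<Longrightarrow> c i = 0" "\<And>j. j \<in> ?A \<Longrightarrow> c' j = c (f j)"
      "\<And>j. j < d \<Longrightarrow> j \<notin> ?A \<Longrightarrow> c' j = 0" for c c'
  proof -
    have "exponent_partition n c = filter_mset (\<lambda>x. x \<noteq> 0) (image_mset (\<lambda>j. c (f j)) (mset_set ?A))"
      using f S that by (intro exponent_partition_reindex[where k = f]) (auto simp: bij_betw_def)
    also have "\<dots> = exponent_partition d c'"
      using S that by (intro exponent_partition_reindex[where k = id, symmetric]) auto
    finally show ?thesis .
  qed
  have zero: "a i = 0" if "(a, \<mu>) \<in> snd ` set U" "i < n" "i \<notin> S" for a \<mu> i
  proof -
    have "integrate_out i (a, \<mu>) = (a, \<mu>)" using U that by blast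
    then show ?thesis by (simp only: integrate_out_fixed_iff)
  qed
  show "0 \<le> kernel_form (moment_matrix n z) U U"
  proof (rule kernel_form_nonneg_if_factors[OF psd finite_matrix_index, of _ g])
    fix s assume s: "s \<in> snd ` set U"
    obtain a \<mu> where s': "s = (a, \<mu>)" by force
    have "exponent_partition n a = exponent_partition d (fst (g s))"
      using S zero s by (intro ep) (auto simp: g_def s')
    then have "(\<Sum>i<n. a i) = (\<Sum>i<d. fst (g s) i)"
      by (metis sum_exponent_partition)
    moreover have "s \<in> weighted_monomials n d" using U s by auto
    ultimately show "g s \<in> matrix_index d"
      by (auto simp: s' g_def weighted_monomials_def matrix_index_def partitions_of_def)
  next
    fix s t assume s: "s \<in> snd ` set U" and t: "t \<in> snd ` set U"
    obtain a \<mu> b \<nu> where st: "s = (a, \<mu>)" "t = (b, \<nu>)" by force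
    have "exponent_partition n (\<lambda>i. a i + b i) = exponent_partition d (\<lambda>i. fst (g s) i + fst (g t) i)"
      using S zero s t by (intro ep) (auto simp: g_def st)
    then show "moment_matrix n z s t = moment_matrix d z (g s) (g t)"
      by (simp add: moment_matrix_def st g_def)
  qed
qed (use U integrate_out_adjoint integrate_out_idem integrate_out_commute integrate_out_weighted
    card_gap_weighted in auto)

section \<open>Linear functionals on polynomials and lowest terms of sums of squares\<close>

definition linear_ext :: "((nat \<Rightarrow>\<^sub>0 nat) \<Rightarrow> real) \<Rightarrow> rpoly \<Rightarrow> real" where
  "linear_ext e q = (\<Sum>m\<in>Poly_Mapping.keys q. Poly_Mapping.lookup q m * e m)"

lemma linear_ext_0 [simp]: "linear_ext e 0 = 0"
  by (simp add: linear_ext_def)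

lemma linear_ext_add: "linear_ext e (p + q) = linear_ext e p + linear_ext e q"
  unfolding linear_ext_def
  by (rule setsum_keys_plus_distrib[of "\<lambda>k x. x * e k"]) (auto simp: distrib_right)

lemma linear_ext_sum: "linear_ext e (\<Sum>i\<in>A. f i) = (\<Sum>i\<in>A. linear_ext e (f i))"
  by (induction A rule: infinite_finite_induct) (simp_all add: linear_ext_add)

lemma linear_ext_single [simp]: "linear_ext e (Poly_Mapping.single m c) = c * e m"
  by (simp add: linear_ext_def)

text \<open>Taking a coefficient is itself a linear functional, so \<open>linear_ext_mult\<close>
  also computes coefficients of products.\<close>

lemma lookup_eq_linear_ext:
  "Poly_Mapping.lookup q k = linear_ext (\<lambda>m. if m = k then 1 else 0) q"
  by (auto simp: linear_ext_def in_keys_iff if_distrib cong: if_cong)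

lemma sum_single_keys:
  "(\<Sum>m\<in>Poly_Mapping.keys q. Poly_Mapping.single m (Poly_Mapping.lookup q m)) = (q :: rpoly)"
proof (rule poly_mapping_eqI)
  fix k
  show "Poly_Mapping.lookup (\<Sum>m\<in>Poly_Mapping.keys q. Poly_Mapping.single m (Poly_Mapping.lookup q m)) k
      = Poly_Mapping.lookup q k"
    by (auto simp: lookup_sum lookup_single when_def in_keys_iff)
qed

lemma linear_ext_mult:
  "linear_ext e (p * q) = (\<Sum>a\<in>Poly_Mapping.keys p. \<Sum>b\<in>Poly_Mapping.keys q.
     Poly_Mapping.lookup p a * Poly_Mapping.lookup q b * e (a + b))"
proof -
  have "p * q = (\<Sum>a\<in>Poly_Mapping.keys p. \<Sum>b\<in>Poly_Mapping.keys q.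
      Poly_Mapping.single (a + b) (Poly_Mapping.lookup p a * Poly_Mapping.lookup q b))"
    by (subst (1 2) sum_single_keys[symmetric]) (simp only: sum_product mult_single)
  then show ?thesis by (simp add: linear_ext_sum)
qed

lemma linear_ext_const_mult: "linear_ext e (const_poly c * q) = c * linear_ext e q"
  unfolding linear_ext_mult by (auto simp: const_poly_def linear_ext_def sum_distrib_left mult_ac)

text \<open>Lowest-degree parts of real squares cannot cancel: for a suitable monomial k of least
  degree, the coefficient at k + k in the sum is a sum of real squares, one of them nonzero. Hence k
  + k has degree at least 2d.\<close>

lemma sum_squares_lowest_degree:
  fixes q :: "'j \<Rightarrow> rpoly" and deg :: "(nat \<Rightarrow>\<^sub>0 nat) \<Rightarrow> nat"
  assumes fin: "finite J"
    and deg_add: "\<And>a b. deg (a + b) = deg a + deg b"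
    and hom: "\<And>m. m \<in> Poly_Mapping.keys (\<Sum>j\<in>J. (q j)^2) \<Longrightarrow> deg m \<ge> 2 * d"
    and j: "j \<in> J" "m \<in> Poly_Mapping.keys (q j)"
  shows "d \<le> deg m"
proof -
  define A where "A = (\<Union>j\<in>J. Poly_Mapping.keys (q j))"
  have finA: "finite A" and "m \<in> A" using fin j by (auto simp: A_def)
  define d0 where "d0 = Min (deg ` A)"
  have d0: "d0 \<le> deg a" if "a \<in> A" for a
    using that finA by (simp add: d0_def)
  define B where "B = {a \<in> A. deg a = d0}"
  have "d0 \<in> deg ` A" using finA \<open>m \<in> A\<close> unfolding d0_def by (intro Min_in) auto
  then have B: "finite B" "B \<noteq> {}" using finA by (auto simp: B_def)
  \<comment> \<open>Lexicographically least among the monomials of least degree, hence a vertex: \<open>2 k\<close> is a sum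
    of two monomials in only one way.\<close>
  define k where "k = Min B"
  have kB: "k \<in> B" using B by (simp add: k_def)
  then have k: "k \<in> A" "deg k = d0" by (auto simp: B_def)
  have vertex: "a = k \<and> b = k" if ab: "a \<in> A" "b \<in> A" "a + b = k + k" for a b
  proof -
    have "deg a + deg b = d0 + d0" using ab(3) k(2) by (metis deg_add)
    then have "a \<in> B" "b \<in> B" using ab d0[of a] d0[of b] by (auto simp: B_def)
    then have "k \<le> a" "k \<le> b" using B by (auto simp: k_def)
    then show ?thesis
      using ab(3) add_less_le_mono[of k a k b] add_le_less_mono[of k a k b] by (auto simp: order.order_iff_strict)
  qed
  have sq: "Poly_Mapping.lookup ((q j)^2) (k + k) = (Poly_Mapping.lookup (q j) k)^2" if "j \<in> J" for j
  proof -
    have "Poly_Mapping.lookup ((q j)^2) (k + k) =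
      (\<Sum>a\<in>Poly_Mapping.keys (q j). \<Sum>b\<in>Poly_Mapping.keys (q j).
        if a = k then if b = k then (Poly_Mapping.lookup (q j) k)^2 else 0 else 0)"
      unfolding lookup_eq_linear_ext[of "(q j)^2"] unfolding power2_eq_square linear_ext_mult
    proof (intro sum.cong refl)
      fix a b assume "a \<in> Poly_Mapping.keys (q j)" "b \<in> Poly_Mapping.keys (q j)"
      then show "Poly_Mapping.lookup (q j) a * Poly_Mapping.lookup (q j) b * (if a + b = k + k then 1 else 0)
        = (if a = k then if b = k then Poly_Mapping.lookup (q j) k * Poly_Mapping.lookup (q j) k else 0 else 0)"
        using vertex[of a b] that by (auto simp: A_def)
    qed
    also have "\<dots> = (Poly_Mapping.lookup (q j) k)^2"
    proof -
      have "(\<Sum>b\<in>Poly_Mapping.keys (q j). if a = k then if b = k then (Poly_Mapping.lookup (q j) k)^2 else 0 else 0)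
        = (if a = k then (Poly_Mapping.lookup (q j) k)^2 else 0)" for a
        by (simp add: in_keys_iff)
      then show ?thesis by (simp add: in_keys_iff)
    qed
    finally show ?thesis .
  qed
  obtain i where i: "i \<in> J" "k \<in> Poly_Mapping.keys (q i)" using k by (auto simp: A_def)
  have "0 < (\<Sum>j\<in>J. (Poly_Mapping.lookup (q j) k)^2)"
    using i fin by (intro sum_pos2[of _ i]) (auto simp: in_keys_iff)
  also have "\<dots> = Poly_Mapping.lookup (\<Sum>j\<in>J. (q j)^2) (k + k)"
    by (simp add: lookup_sum sq)
  finally have "deg (k + k) \<ge> 2 * d" using hom by (simp add: in_keys_iff)
  then show ?thesis using d0[OF \<open>m \<in> A\<close>] k by (simp add: deg_add)
qed

section \<open>Expansion of products of power means\<close>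

lemma const_poly_add: "const_poly (a + b) = const_poly a + const_poly b"
  by (simp add: const_poly_def single_add)

lemma const_poly_mult: "const_poly (a * b) = const_poly a * const_poly b"
  by (simp add: const_poly_def mult_single)

lemma const_poly_0 [simp]: "const_poly 0 = 0" and const_poly_1 [simp]: "const_poly 1 = 1"
  by (simp_all add: const_poly_def)

lemma const_poly_sum: "const_poly (\<Sum>i\<in>A. f i) = (\<Sum>i\<in>A. const_poly (f i))"
  by (induction A rule: infinite_finite_induct) (simp_all add: const_poly_add)

lemma const_poly_power: "const_poly (a ^ k) = const_poly a ^ k"
  by (induction k) (simp_all add: const_poly_mult)

text \<open>The product of the powers of \<open>x_(k i)\<close> with exponents \<open>r i\<close>.
  Where \<open>k\<close> repeats an index, the exponents add.\<close>

definition tuple_monomial :: "'i set \<Rightarrow> ('i \<Rightarrow> nat) \<Rightarrow> ('i \<Rightarrow> nat) \<Rightarrow> nat \<Rightarrow>\<^sub>0 nat" where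
  "tuple_monomial A k r = (\<Sum>i\<in>A. Poly_Mapping.single (k i) (r i))"

lemma var_poly_power: "var_poly i ^ r = Poly_Mapping.single (Poly_Mapping.single i r) 1"
  by (induction r) (simp_all add: var_poly_def mult_single flip: single_add)

lemma prod_single: "(\<Prod>i\<in>A. Poly_Mapping.single (f i) (1::real)) = Poly_Mapping.single (\<Sum>i\<in>A. f i) 1"
  by (induction A rule: infinite_finite_induct) (simp_all add: mult_single)

text \<open>Multiplying out picks one variable per factor independently, so the product is the
  average over all maps \<open>k\<close>, injective or not.\<close>

lemma prod_power_mean:
  assumes "finite A"
  shows "(\<Prod>i\<in>A. power_mean n (r i)) = const_poly ((1 / real n) ^ card A) *
    (\<Sum>k\<in>A \<rightarrow>\<^sub>E {..<n}. Poly_Mapping.single (tuple_monomial A k r) 1)"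
  using assms
  by (simp add: power_mean_def prod.distrib const_poly_power var_poly_power prod_sum_PiE prod_single
      tuple_monomial_def)

lemma power_mean_0: "n \<ge> 1 \<Longrightarrow> power_mean n 0 = 1"
  using const_poly_mult[of "1 / real n" "real n"]
  by (simp add: power_mean_def const_poly_def[of "real n"])

lemma power_mean_partition_add:
  "power_mean_partition n (\<mu> + \<nu>) = power_mean_partition n \<mu> * power_mean_partition n \<nu>"
  by (simp add: power_mean_partition_def)

text \<open>The zero exponents discarded by \<open>exponent_partition\<close> correspond to factors
  \<open>power_mean n 0 = 1\<close>.\<close>

lemma power_mean_exponent_partition:
  assumes "n \<ge> 1"
  shows "power_mean_partition n (exponent_partition d a) = (\<Prod>i<d. power_mean n (a i))"
proof -
  have "power_mean_partition n (filter_mset (\<lambda>x. x \<noteq> 0) M) = power_mean_partition n M" for M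
    using assms by (induction M) (auto simp: power_mean_partition_def power_mean_0)
  then show ?thesis
    by (simp add: exponent_partition_def power_mean_partition_def prod_unfold_prod_mset
        multiset.map_comp o_def)
qed


section \<open>Averaged squares and positive semidefiniteness on the dual cone\<close>

lemma polys_in_add: "p \<in> polys_in n \<Longrightarrow> q \<in> polys_in n \<Longrightarrow> p + q \<in> polys_in n"
  using Poly_Mapping.keys_add[of p q] by (auto simp: polys_in_def)

lemma polys_in_mult:
  assumes "p \<in> polys_in n" "q \<in> polys_in n"
  shows "p * q \<in> polys_in n"
  unfolding polys_in_def
proof clarify
  fix m x assume "m \<in> Poly_Mapping.keys (p * q)" and x: "x \<in> Poly_Mapping.keys m"
  then obtain a b where "m = a + b" "a \<in> Poly_Mapping.keys p" "b \<in> Poly_Mapping.keys q"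
    using keys_mult[of p q] by blast
  then show "x < n"
    using x Poly_Mapping.keys_add[of a b] assms by (auto simp: polys_in_def)
qed

lemma polys_in_single: "Poly_Mapping.keys m \<subseteq> {..<n} \<Longrightarrow> Poly_Mapping.single m c \<in> polys_in n"
  by (simp add: polys_in_def)

lemma polys_in_const_poly: "const_poly c \<in> polys_in n"
  by (simp add: const_poly_def polys_in_single)

lemma polys_in_sum: "(\<And>i. i \<in> A \<Longrightarrow> f i \<in> polys_in n) \<Longrightarrow> (\<Sum>i\<in>A. f i) \<in> polys_in n"
  using polys_in_const_poly[of 0 n]
  by (induction A rule: infinite_finite_induct) (simp_all add: polys_in_add)

lemma polys_in_power_mean: "power_mean n r \<in> polys_in n"
  unfolding power_mean_def var_poly_power
  by (intro polys_in_mult polys_in_const_poly polys_in_sum polys_in_single) auto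

lemma polys_in_power_mean_partition: "power_mean_partition n \<mu> \<in> polys_in n"
proof (induction \<mu>)
  case empty
  then show ?case
    using polys_in_const_poly[of 1 n] by (simp add: power_mean_partition_def)
next
  case (add x \<mu>)
  then show ?case
    using polys_in_mult polys_in_power_mean by (simp add: power_mean_partition_def)
qed

lemma keys_tuple_monomial: "k ` A \<subseteq> {..<n} \<Longrightarrow> Poly_Mapping.keys (tuple_monomial A k r) \<subseteq> {..<n}"
  unfolding tuple_monomial_def
  using keys_sum[of "\<lambda>i. Poly_Mapping.single (k i) (r i)" A] by (fastforce split: if_splits)

lemma tuple_monomial_add:
  "tuple_monomial A k r + tuple_monomial A k s = tuple_monomial A k (\<lambda>i. r i + s i)"
  by (simp add: tuple_monomial_def sum.distrib single_add)

lemma sum_of_squares_sum: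
  assumes "finite A" "\<And>a. a \<in> A \<Longrightarrow> q a \<in> polys_in n"
  shows "sum_of_squares n (\<Sum>a\<in>A. (q a)^2)"
proof -
  obtain h where h: "bij_betw h {..<card A} A"
    using ex_bij_betw_nat_finite[OF assms(1)] by (auto simp: atLeast0LessThan)
  have "(\<Sum>a\<in>A. (q a)^2) = (\<Sum>j<card A. (q (h j))^2)"
    using sum.reindex_bij_betw[OF h, of "\<lambda>a. (q a)^2"] by simp
  moreover have "q (h j) \<in> polys_in n" if "j < card A" for j
    using assms(2) bij_betwE[OF h] that by auto
  ultimately show ?thesis
    unfolding sum_of_squares_def by (intro exI[of _ "card A"] exI[of _ "\<lambda>j. q (h j)"]) simp
qed

text \<open>
  The average of the square of \<open>\<Sum> v\<^bsub>\<alpha>\<mu>\<^esub> x\<^sup>\<alpha> p\<^sub>\<mu>\<close> over all substitutions, repetitions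
  allowed, of \<open>n\<close> variables for \<open>x\<^sub>1, ..., x\<^sub>d\<close>.
\<close>

lemma sum_of_squares_quadratic_form:
  fixes I :: "((nat \<Rightarrow> nat) \<times> nat multiset) set"
  assumes "n \<ge> 1" "finite I"
  shows "sum_of_squares n (\<Sum>p\<in>I. \<Sum>p'\<in>I. const_poly (v p * v p') *
    power_mean_partition n (exponent_partition d (\<lambda>i. fst p i + fst p' i) + snd p + snd p'))"
proof -
  let ?D = "{..<d}" and ?c = "(1 / real n) ^ d"
  define x where "x k p = Poly_Mapping.single (tuple_monomial ?D k (fst p)) (1::real)"
    for k and p :: "(nat \<Rightarrow> nat) \<times> nat multiset"
  define y where "y p = power_mean_partition n (snd p)" for p :: "(nat \<Rightarrow> nat) \<times> nat multiset"
  \<comment> \<open>Each of the n^d substitutions has weight n^(-d). The square root of this weight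
    is moved inside the square.\<close>
  define q where "q k = const_poly (sqrt ?c) * (\<Sum>p\<in>I. const_poly (v p) * (x k p * y p))" for k
  have xx: "const_poly ?c * (\<Sum>k\<in>?D \<rightarrow>\<^sub>E {..<n}. x k p * x k p') =
      power_mean_partition n (exponent_partition d (\<lambda>i. fst p i + fst p' i))" for p p'
    unfolding x_def mult_single tuple_monomial_add power_mean_exponent_partition[OF assms(1)]
      prod_power_mean[OF finite_lessThan] by simp
  have "(q k)^2 = (\<Sum>p\<in>I. \<Sum>p'\<in>I. const_poly ?c * (const_poly (v p * v p') * (y p * y p')) * (x k p * x k p'))" for k
  proof -
    have "const_poly (sqrt ?c) ^ 2 = const_poly ?c"
      by (simp flip: const_poly_power)
    then have "(q k)^2 = const_poly ?c * ((\<Sum>p\<in>I. const_poly (v p) * (x k p * y p)) *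
        (\<Sum>p\<in>I. const_poly (v p) * (x k p * y p)))"
      by (simp add: q_def power_mult_distrib power2_eq_square)
    also have "\<dots> = const_poly ?c * (\<Sum>p\<in>I. \<Sum>p'\<in>I.
        const_poly (v p) * (x k p * y p) * (const_poly (v p') * (x k p' * y p')))"
      by (simp only: sum_product)
    finally show ?thesis
      unfolding sum_distrib_left by (simp add: const_poly_mult mult_ac)
  qed
  then have "(\<Sum>k\<in>?D \<rightarrow>\<^sub>E {..<n}. (q k)^2) =
      (\<Sum>k\<in>?D \<rightarrow>\<^sub>E {..<n}. \<Sum>p\<in>I. \<Sum>p'\<in>I. const_poly ?c * (const_poly (v p * v p') * (y p * y p')) * (x k p * x k p'))"
    by simp
  also have "\<dots> = (\<Sum>p\<in>I. \<Sum>p'\<in>I. \<Sum>k\<in>?D \<rightarrow>\<^sub>E {..<n}.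
      const_poly ?c * (const_poly (v p * v p') * (y p * y p')) * (x k p * x k p'))"
    by (subst sum.swap, rule sum.cong[OF refl], subst sum.swap, rule refl)
  also have "\<dots> = (\<Sum>p\<in>I. \<Sum>p'\<in>I. const_poly (v p * v p') * (y p * y p') *
      (const_poly ?c * (\<Sum>k\<in>?D \<rightarrow>\<^sub>E {..<n}. x k p * x k p')))"
    by (simp add: sum_distrib_left mult_ac)
  also have "\<dots> = (\<Sum>p\<in>I. \<Sum>p'\<in>I. const_poly (v p * v p') *
      power_mean_partition n (exponent_partition d (\<lambda>i. fst p i + fst p' i) + snd p + snd p'))"
    unfolding xx by (simp add: power_mean_partition_add y_def mult_ac)
  finally have eq: "(\<Sum>k\<in>?D \<rightarrow>\<^sub>E {..<n}. (q k)^2) = \<dots>" .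
  have "q k \<in> polys_in n" if "k \<in> ?D \<rightarrow>\<^sub>E {..<n}" for k
    unfolding q_def x_def y_def using that
    by (intro polys_in_mult polys_in_const_poly polys_in_sum polys_in_single
        polys_in_power_mean_partition keys_tuple_monomial) auto
  then show ?thesis
    unfolding eq[symmetric] by (intro sum_of_squares_sum finite_PiE) auto
qed

lemma partition_of_index_pair:
  assumes "p \<in> matrix_index d" "p' \<in> matrix_index d"
  shows "exponent_partition d (\<lambda>i. fst p i + fst p' i) + snd p + snd p' \<in> partitions_of (2 * d)"
proof -
  have "0 \<notin># snd p \<and> sum (fst p) {..<d} + sum_mset (snd p) = d" if "p \<in> matrix_index d" for p
  proof -
    obtain \<alpha> \<mu> where p: "p = (\<alpha>, \<mu>)" by force
    show ?thesis using that unfolding p matrix_index_def partitions_of_def by fastforce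
  qed
  from this[OF assms(1)] this[OF assms(2)] show ?thesis
    by (simp add: partitions_of_def zero_notin_exponent_partition sum_exponent_partition sum.distrib)
qed

text \<open>For each \<open>v\<close>, the averaged square with coefficients \<open>v\<close> has
  coordinates \<open>c\<close> that are independent of n, so \<open>c\<close> lies in the cone.
  Pairing \<open>z\<close> with \<open>c\<close> gives the quadratic form of the moment matrix at
  \<open>v\<close>.\<close>

lemma psd_if_dual_cone:
  assumes d: "d \<ge> 1" and z: "z \<in> dual_cone (partitions_of (2 * d)) (sos_cone d)"
  shows "positive_semidefinite (matrix_index d) (moment_matrix d z)"
  unfolding positive_semidefinite_def
proof (intro conjI ballI allI)
  show "moment_matrix d z p p' = moment_matrix d z p' p" for p p'
    by (auto simp: moment_matrix_def add_ac split: prod.splits)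
next
  fix v :: "(nat \<Rightarrow> nat) \<times> nat multiset \<Rightarrow> real"
  let ?I = "matrix_index d" and ?T = "partitions_of (2 * d)"
  define key where "key = (\<lambda>(p, p'). exponent_partition d (\<lambda>i. fst p i + fst p' i) + snd p + snd p' :: nat multiset)"
  define w where "w = (\<lambda>(p, p'). v p * v p')"
  \<comment> \<open>Several index pairs can yield the same partition; their weights are collected
    into one coordinate.\<close>
  define c where "c = (\<lambda>\<mu>\<in>?T. \<Sum>p\<in>{p \<in> ?I \<times> ?I. key p = \<mu>}. w p)"
  have fin: "finite (?I \<times> ?I)" by (simp add: finite_matrix_index)
  have key: "key ` (?I \<times> ?I) \<subseteq> ?T"
    using partition_of_index_pair by (auto simp: key_def)
  have "c \<in> sos_cone d"
    unfolding sos_cone_def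
  proof (intro CollectI conjI allI impI)
    show "c \<in> ?T \<rightarrow>\<^sub>E UNIV" by (simp add: c_def)
    fix n assume "n \<ge> 2 * d"
    then have n: "n \<ge> 1" using d by simp
    have "(\<Sum>\<mu>\<in>?T. const_poly (c \<mu>) * power_mean_partition n \<mu>) =
        (\<Sum>\<mu>\<in>?T. \<Sum>p\<in>{p \<in> ?I \<times> ?I. key p = \<mu>}. const_poly (w p) * power_mean_partition n (key p))"
      by (intro sum.cong refl) (simp add: c_def const_poly_sum sum_distrib_right)
    also have "\<dots> = (\<Sum>p\<in>?I \<times> ?I. const_poly (w p) * power_mean_partition n (key p))"
      by (rule sum.group[OF fin finite_partitions_of key])
    also have "\<dots> = (\<Sum>p\<in>?I. \<Sum>p'\<in>?I. const_poly (w (p, p')) * power_mean_partition n (key (p, p')))"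
      by (simp add: sum.cartesian_product case_prod_unfold)
    finally show "sum_of_squares n (\<Sum>\<mu>\<in>?T. const_poly (c \<mu>) * power_mean_partition n \<mu>)"
      using sum_of_squares_quadratic_form[OF n finite_matrix_index, of v d d]
      by (simp add: w_def key_def)
  qed
  then have "0 \<le> (\<Sum>\<mu>\<in>?T. z \<mu> * c \<mu>)"
    using z by (auto simp: dual_cone_def)
  also have "\<dots> = (\<Sum>\<mu>\<in>?T. \<Sum>p\<in>{p \<in> ?I \<times> ?I. key p = \<mu>}. z (key p) * w p)"
    by (intro sum.cong refl) (simp add: c_def sum_distrib_left)
  also have "\<dots> = (\<Sum>p\<in>?I \<times> ?I. z (key p) * w p)"
    by (rule sum.group[OF fin finite_partitions_of key])
  also have "\<dots> = (\<Sum>p\<in>?I. \<Sum>p'\<in>?I. v p * moment_matrix d z p p' * v p')"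
    by (simp add: sum.cartesian_product case_prod_unfold w_def key_def moment_matrix_def mult_ac)
  finally show "0 \<le> (\<Sum>p\<in>?I. \<Sum>p'\<in>?I. v p * moment_matrix d z p p' * v p')" .
qed

section \<open>The limit of many variables and the converse inclusion\<close>

text \<open>Injectivity of \<open>k\<close> keeps the exponents from merging, so the partition
  consists of the nonzero values of \<open>r\<close>.\<close>

lemma exponent_partition_tuple_monomial:
  assumes "finite A" "inj_on k A" "k ` A \<subseteq> {..<n}"
  shows "exponent_partition n (Poly_Mapping.lookup (tuple_monomial A k r)) =
    filter_mset (\<lambda>x. x \<noteq> 0) (image_mset r (mset_set A))"
proof (rule exponent_partition_reindex[OF assms])
  fix i assume i: "i \<in> A"
  have "Poly_Mapping.lookup (tuple_monomial A k r) (k i) = (\<Sum>j\<in>A. if j = i then r j else 0)"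
    unfolding tuple_monomial_def lookup_sum lookup_single when_def
    using assms(2) i by (intro sum.cong) (auto simp: inj_on_eq_iff)
  then show "Poly_Mapping.lookup (tuple_monomial A k r) (k i) = r i"
    using assms(1) i by simp
qed (auto simp: tuple_monomial_def lookup_sum lookup_single when_def intro!: sum.neutral)

text \<open>
  All but a fraction \<open>O(1/n)\<close> of the terms of the expanded product of power means involve pairwise
  distinct variables, and on those the functional takes the value \<open>z \<mu>\<close>.
\<close>

lemma linear_ext_power_mean_partition_tendsto:
  fixes z :: "nat multiset \<Rightarrow> real"
  assumes bdd: "\<And>\<nu>. \<bar>z \<nu>\<bar> \<le> C" and \<mu>: "0 \<notin># \<mu>"
  shows "(\<lambda>n. linear_ext (\<lambda>m. z (exponent_partition n (Poly_Mapping.lookup m))) (power_mean_partition n \<mu>))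
    \<longlonglongrightarrow> z \<mu>"
proof -
  obtain xs where xs: "mset xs = \<mu>" using ex_mset by blast
  define l where "l = length xs"
  define r where "r i = xs ! i" for i
  let ?A = "{..<l}"
  have "mset xs = image_mset r (mset_set ?A)"
  proof -
    have "mset (map r [0..<l]) = image_mset r (mset_set ?A)"
      by (simp only: mset_map mset_upt atLeast0LessThan)
    moreover have "map r [0..<l] = xs"
      unfolding r_def l_def by (rule map_nth)
    ultimately show ?thesis by simp
  qed
  then have \<mu>_eq: "image_mset r (mset_set ?A) = \<mu>" using xs by simp
  define S where "S n = ?A \<rightarrow>\<^sub>E {..<n::nat}" for n
  define T where "T n = {k \<in> S n. inj_on k ?A}" for n
  define g where "g n k = z (exponent_partition n (Poly_Mapping.lookup (tuple_monomial ?A k r)))" for n k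
  define a where "a n = linear_ext (\<lambda>m. z (exponent_partition n (Poly_Mapping.lookup m)))
    (power_mean_partition n \<mu>)" for n
  \<comment> \<open>The proportion of injective maps among all maps from l points to n points.
    Truncated subtraction makes it 0 when 0 < n < l, as it should be.\<close>
  define b where "b n = (\<Prod>i<l. real (n - i) / real n)" for n
  have fin: "finite (S n)" for n by (auto simp: S_def intro!: finite_PiE)
  have a_eq: "a n = (1 / real n) ^ l * (\<Sum>k\<in>S n. g n k)" for n
  proof -
    have "power_mean_partition n \<mu> = (\<Prod>i\<in>?A. power_mean n (r i))"
      by (simp add: power_mean_partition_def prod_unfold_prod_mset multiset.map_comp o_def flip: \<mu>_eq)
    then show ?thesis
      by (simp add: a_def prod_power_mean linear_ext_const_mult linear_ext_sum S_def g_def)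
  qed
  have cardS: "real (card (S n)) = real n ^ l" for n
    by (simp add: S_def card_funcsetE)
  have cardT: "real (card (T n)) = real n ^ l * b n" if "n \<ge> 1" for n
  proof -
    have "card (T n) = (\<Prod>i<l. n - i)"
      using card_inj_on_subset_funcset[of ?A "{..<n}" ?A]
      by (simp add: T_def S_def atLeast0LessThan)
    then show ?thesis using that by (simp add: b_def prod_dividef)
  qed
  have gT: "g n k = z \<mu>" if "k \<in> T n" for n k
  proof -
    have "filter_mset (\<lambda>x. x \<noteq> 0) \<mu> = \<mu>" using \<mu> by (auto simp: filter_mset_eq_conv intro!: gr0I)
    then show ?thesis
      using that exponent_partition_tuple_monomial[of ?A k n r]
      by (auto simp: g_def T_def S_def \<mu>_eq)
  qed
  \<comment> \<open>Injective maps contribute no error, and each other map at most 2C.\<close>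
  have bound: "norm (a n - z \<mu>) \<le> (1 - b n) * (2 * C)" if n: "n \<ge> 1" for n
  proof -
    have TS: "T n \<subseteq> S n" by (auto simp: T_def)
    have "(1 / real n) ^ l * (\<Sum>k\<in>S n. z \<mu>) = z \<mu>"
      using n by (simp add: cardS power_divide)
    then have "a n - z \<mu> = (1 / real n) ^ l * (\<Sum>k\<in>S n. g n k - z \<mu>)"
      unfolding a_eq sum_subtractf right_diff_distrib by simp
    also have "(\<Sum>k\<in>S n. g n k - z \<mu>) = (\<Sum>k\<in>S n - T n. g n k - z \<mu>)"
      using gT fin TS by (intro sum.mono_neutral_right) auto
    finally have norm: "norm (a n - z \<mu>) = (1 / real n) ^ l * \<bar>\<Sum>k\<in>S n - T n. g n k - z \<mu>\<bar>"
      by (simp add: abs_mult)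
    have "\<bar>\<Sum>k\<in>S n - T n. g n k - z \<mu>\<bar> \<le> (\<Sum>k\<in>S n - T n. 2 * C)"
    proof (rule order_trans[OF sum_abs], rule sum_mono)
      fix k
      show "\<bar>g n k - z \<mu>\<bar> \<le> 2 * C"
        using bdd[of \<mu>] bdd[of "exponent_partition n (Poly_Mapping.lookup (tuple_monomial ?A k r))"]
        unfolding g_def by linarith
    qed
    also have "(\<Sum>k\<in>S n - T n. 2 * C) = (real (card (S n)) - real (card (T n))) * (2 * C)"
      using card_Diff_subset[of "T n" "S n"] card_mono[OF fin TS] TS fin finite_subset[OF TS fin]
      by (simp add: of_nat_diff)
    also have "\<dots> = real n ^ l * (1 - b n) * (2 * C)"
      by (simp add: cardS cardT[OF n] right_diff_distrib)
    finally have "norm (a n - z \<mu>) \<le> (1 / real n) ^ l * (real n ^ l * (1 - b n) * (2 * C))"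
      unfolding norm by (intro mult_left_mono) auto
    then show ?thesis using n by (simp add: power_divide)
  qed
  have "b \<longlonglongrightarrow> (\<Prod>i<l. 1)"
    unfolding b_def
  proof (rule tendsto_prod)
    fix i
    have "(\<lambda>n. 1 - real i / real n) \<longlonglongrightarrow> 1 - 0"
      by (intro tendsto_intros lim_const_over_n)
    \<comment> \<open>From max 1 i onwards the subtraction is not truncated and the denominator is
      nonzero.\<close>
    moreover have "eventually (\<lambda>n. 1 - real i / real n = real (n - i) / real n) sequentially"
      using eventually_ge_at_top[of "max 1 i"]
      by eventually_elim (simp add: of_nat_diff diff_divide_distrib)
    ultimately show "(\<lambda>n. real (n - i) / real n) \<longlonglongrightarrow> 1"
      by (simp add: tendsto_cong)
  qed
  then have "(\<lambda>n. (1 - b n) * (2 * C)) \<longlonglongrightarrow> (1 - 1) * (2 * C)"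
    by (intro tendsto_intros) simp_all
  then have "(\<lambda>n. (1 - b n) * (2 * C)) \<longlonglongrightarrow> 0" by simp
  then have "(\<lambda>n. a n - z \<mu>) \<longlonglongrightarrow> 0"
  proof (rule tendsto_0_le)
    have "norm (a n - z \<mu>) \<le> norm ((1 - b n) * (2 * C)) * 1" if "n \<ge> 1" for n
      using bound[OF that] by simp
    then show "eventually (\<lambda>n. norm (a n - z \<mu>) \<le> norm ((1 - b n) * (2 * C)) * 1) sequentially"
      using eventually_ge_at_top[of "1::nat"] by (rule eventually_mono[rotated])
  qed
  then have "a \<longlonglongrightarrow> z \<mu>" by (rule LIM_zero_cancel)
  then show ?thesis unfolding a_def .
qed

text \<open>As \<open>q\<close> has no terms of degree below d, a product involving a term of higher
  degree has degree above 2d, where \<open>z\<close> vanishes. Only the degree d part of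
  \<open>q\<close> counts, and its square is handled by the moment kernel.\<close>

lemma linear_ext_square_nonneg:
  fixes q :: rpoly
  assumes psd: "positive_semidefinite (matrix_index d) (moment_matrix d z)"
    and zero: "\<And>\<mu>. \<mu> \<notin> partitions_of (2 * d) \<Longrightarrow> z \<mu> = 0"
    and low: "\<And>m. m \<in> Poly_Mapping.keys q \<Longrightarrow> d \<le> (\<Sum>i<n. Poly_Mapping.lookup m i)"
  shows "0 \<le> linear_ext (\<lambda>m. z (exponent_partition n (Poly_Mapping.lookup m))) (q^2)"
proof -
  let ?deg = "\<lambda>m. \<Sum>i<n. Poly_Mapping.lookup m i"
  define k where "k = {m \<in> Poly_Mapping.keys q. ?deg m = d}"
  have fin: "finite k" by (simp add: k_def)
  then obtain ms where ms: "set ms = k" "distinct ms" using finite_distinct_list by blast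
  \<comment> \<open>The degree d part of \<open>q\<close>, written without formal power means; these
    appear only once variables are integrated out.\<close>
  define U where "U = map (\<lambda>m. (Poly_Mapping.lookup q m, (Poly_Mapping.lookup m, {#} :: nat multiset))) ms"
  let ?t = "\<lambda>a b. Poly_Mapping.lookup q a * Poly_Mapping.lookup q b * z (exponent_partition n (Poly_Mapping.lookup (a + b)))"
  have vanish: "z (exponent_partition n (Poly_Mapping.lookup (a + b))) = 0"
    if "a \<in> Poly_Mapping.keys q" "b \<in> Poly_Mapping.keys q" "a \<notin> k \<or> b \<notin> k" for a b
  proof (rule zero)
    have "?deg (a + b) = ?deg a + ?deg b" by (simp add: lookup_add sum.distrib)
    then show "exponent_partition n (Poly_Mapping.lookup (a + b)) \<notin> partitions_of (2 * d)"
      using that low[of a] low[of b] by (auto simp: partitions_of_def sum_exponent_partition k_def)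
  qed
  have "linear_ext (\<lambda>m. z (exponent_partition n (Poly_Mapping.lookup m))) (q^2) =
      (\<Sum>a\<in>Poly_Mapping.keys q. \<Sum>b\<in>Poly_Mapping.keys q. ?t a b)"
    by (simp add: power2_eq_square linear_ext_mult)
  also have "\<dots> = (\<Sum>a\<in>k. \<Sum>b\<in>Poly_Mapping.keys q. ?t a b)"
    using vanish by (intro sum.mono_neutral_right) (auto simp: k_def intro!: sum.neutral)
  also have "\<dots> = (\<Sum>a\<in>k. \<Sum>b\<in>k. ?t a b)"
    using vanish by (intro sum.cong refl sum.mono_neutral_right) (auto simp: k_def)
  also have "\<dots> = (\<Sum>a\<leftarrow>ms. \<Sum>b\<leftarrow>ms. ?t a b)"
    using ms by (simp add: sum_list_distinct_conv_sum_set)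
  also have "\<dots> = kernel_form (moment_matrix n z) U U"
    by (simp add: kernel_form_def U_def o_def moment_matrix_def plus_poly_mapping.rep_eq)
  also have "\<dots> \<ge> 0"
    using ms by (intro moment_kernel_nonneg[OF psd]) (auto simp: U_def weighted_monomials_def k_def)
  finally show ?thesis .
qed

lemma keys_power_mean_partition_degree:
  assumes "n \<ge> 1" "m \<in> Poly_Mapping.keys (power_mean_partition n \<mu>)"
  shows "(\<Sum>i<n. Poly_Mapping.lookup m i) = sum_mset \<mu>"
  using assms(2)
proof (induction \<mu> arbitrary: m)
  case empty
  then show ?case by (simp add: power_mean_partition_def)
next
  case (add r \<mu>)
  then obtain a b where m: "m = a + b" "a \<in> Poly_Mapping.keys (power_mean n r)"
    "b \<in> Poly_Mapping.keys (power_mean_partition n \<mu>)"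
    using keys_mult[of "power_mean n r" "power_mean_partition n \<mu>"]
    by (auto simp: power_mean_partition_def)
  obtain j where j: "j < n" "a = Poly_Mapping.single j r"
  proof -
    obtain a' b' where "a = a' + b'" "a' \<in> Poly_Mapping.keys (const_poly (1 / real n))"
      "b' \<in> Poly_Mapping.keys (\<Sum>i<n. var_poly i ^ r)"
      using m(2) keys_mult unfolding power_mean_def by blast
    then show ?thesis
      using that keys_sum[of "\<lambda>i. var_poly i ^ r" "{..<n}"]
      by (auto simp: const_poly_def var_poly_power split: if_splits)
  qed
  have "(\<Sum>i<n. Poly_Mapping.lookup a i) = r"
    using j by (simp add: lookup_single when_def)
  then show ?case using add.IH[OF m(3)] by (simp add: m(1) lookup_add sum.distrib)
qed

lemma dual_cone_if_psd:
  assumes d: "d \<ge> 1" and z: "z \<in> partitions_of (2 * d) \<rightarrow>\<^sub>E UNIV"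
    and psd: "positive_semidefinite (matrix_index d) (moment_matrix d z)"
  shows "z \<in> dual_cone (partitions_of (2 * d)) (sos_cone d)"
  unfolding dual_cone_def
proof (intro CollectI conjI ballI z)
  let ?T = "partitions_of (2 * d)"
  fix c assume c: "c \<in> sos_cone d"
  \<comment> \<open>Off the partitions of 2d the vector \<open>z\<close> is
    \<open>undefined\<close>. Setting it to 0 there leaves the moment matrix unchanged, makes the
    functional vanish in other degrees, and gives the uniform bound needed for the limit.\<close>
  define z' where "z' \<mu> = (if \<mu> \<in> ?T then z \<mu> else 0)" for \<mu>
  have "moment_matrix d z' p p' = moment_matrix d z p p'"
    if "p \<in> matrix_index d" "p' \<in> matrix_index d" for p p'
    using partition_of_index_pair[OF that]
    by (simp add: moment_matrix_def z'_def case_prod_unfold)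
  then have psd': "positive_semidefinite (matrix_index d) (moment_matrix d z')"
    using psd by (simp add: positive_semidefinite_def)
  have bdd: "\<bar>z' \<mu>\<bar> \<le> (\<Sum>\<nu>\<in>?T. \<bar>z \<nu>\<bar>)" for \<mu>
    by (auto simp: z'_def finite_partitions_of intro!: member_le_sum sum_nonneg)
  let ?E = "\<lambda>n. linear_ext (\<lambda>m. z' (exponent_partition n (Poly_Mapping.lookup m)))"
  define f where "f n = (\<Sum>\<mu>\<in>?T. const_poly (c \<mu>) * power_mean_partition n \<mu>)" for n
  have "0 \<le> ?E n (f n)" if n: "n \<ge> 2 * d" for n
  proof -
    have "sum_of_squares n (f n)" using c n by (auto simp: sos_cone_def f_def)
    then obtain k :: nat and q where q: "f n = (\<Sum>j<k. (q j)^2)"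
      by (auto simp: sum_of_squares_def)
    \<comment> \<open>Homogeneity of degree 2d forces every term of each \<open>q j\<close> to have
      degree at least d.\<close>
    have hom: "(\<Sum>i<n. Poly_Mapping.lookup m i) = 2 * d" if m: "m \<in> Poly_Mapping.keys (f n)" for m
    proof -
      obtain \<mu> where \<mu>: "\<mu> \<in> ?T" "m \<in> Poly_Mapping.keys (const_poly (c \<mu>) * power_mean_partition n \<mu>)"
        using m keys_sum[of "\<lambda>\<mu>. const_poly (c \<mu>) * power_mean_partition n \<mu>" ?T] by (auto simp: f_def)
      then have "m \<in> Poly_Mapping.keys (power_mean_partition n \<mu>)"
        using keys_mult[of "const_poly (c \<mu>)" "power_mean_partition n \<mu>"]
        by (auto simp: const_poly_def split: if_splits)
      then show ?thesis
        using keys_power_mean_partition_degree[of n m \<mu>] \<mu>(1) n d by (simp add: partitions_of_def)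
    qed
    have "d \<le> (\<Sum>i<n. Poly_Mapping.lookup m i)" if "j < k" "m \<in> Poly_Mapping.keys (q j)" for j m
      by (rule sum_squares_lowest_degree[of "{..<k}" "\<lambda>m. \<Sum>i<n. Poly_Mapping.lookup m i" q d j m])
        (use that hom q in \<open>auto simp: lookup_add sum.distrib\<close>)
    then have "0 \<le> (\<Sum>j<k. ?E n ((q j)^2))"
      by (intro sum_nonneg linear_ext_square_nonneg[OF psd']) (auto simp: z'_def)
    then show ?thesis by (simp add: q linear_ext_sum)
  qed
  moreover have "(\<lambda>n. ?E n (f n)) \<longlonglongrightarrow> (\<Sum>\<mu>\<in>?T. c \<mu> * z' \<mu>)"
    unfolding f_def linear_ext_sum linear_ext_const_mult
    using bdd by (intro tendsto_sum tendsto_mult_left linear_ext_power_mean_partition_tendsto)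
      (auto simp: partitions_of_def)
  ultimately have "0 \<le> (\<Sum>\<mu>\<in>?T. c \<mu> * z' \<mu>)"
    by (intro LIMSEQ_le_const) auto
  then show "0 \<le> (\<Sum>\<mu>\<in>?T. z \<mu> * c \<mu>)"
    by (simp add: z'_def mult.commute)
qed

theorem theorem3p23:
  fixes d :: nat
  assumes "d \<ge> 1"
  shows "dual_cone (partitions_of (2 * d)) (sos_cone d) =
    {z \<in> partitions_of (2 * d) \<rightarrow>\<^sub>E UNIV.
       positive_semidefinite (matrix_index d) (moment_matrix d z)}"
proof (intro equalityI subsetI)
  fix z assume z: "z \<in> dual_cone (partitions_of (2 * d)) (sos_cone d)"
  then have "z \<in> partitions_of (2 * d) \<rightarrow>\<^sub>E UNIV" by (simp add: dual_cone_def)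
  then show "z \<in> {z \<in> partitions_of (2 * d) \<rightarrow>\<^sub>E UNIV.
      positive_semidefinite (matrix_index d) (moment_matrix d z)}"
    using psd_if_dual_cone[OF assms z] by simp
qed (use dual_cone_if_psd[OF assms] in auto)

end
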